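(* Let $G$ be a connected finite simple graph on $n$ vertices and let $r$ be the number of supporting vertices of $G$. Then the number of vertices of degree $2$ in $G$ is at least $$\binom{n}{2}-\binom{r}{2}-r(n-r)-d_t(G,n-2).$$
   Context: A pendant vertex is a vertex of degree $1$; a supporting vertex is a vertex adjacent to some pendant vertex. A set $D\subseteq V(G)$ is a total dominating set of $G$ if every vertex of $G$ is adjacent to some vertex of $D$; $d_t(G,i)$ denotes the number of total dominating sets of $G$ of size $i$. *)

theory Defs
  imports Main "Graph_Theory.Digraph_Component"
begin

text \<open>
  Finite simple graphs are the locale \<open>graph\<close>: finite symmetric digraphs without loops and
  without parallel arcs. Each undirected edge \<open>uv\<close> is represented by the two arcs
  \<open>u \<rightarrow> v\<close> and \<open>v \<rightarrow> u\<close>, so adjacency is \<open>u \<rightarrow>\<^bsub>G\<^esub> v\<close> and the degree of a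
  vertex is its out-degree. The predicate \<open>connected\<close> requires a nonempty vertex set.
\<close>

definition pendant :: "('a, 'b) pre_digraph \<Rightarrow> 'a \<Rightarrow> bool" where
  "pendant G v \<longleftrightarrow> v \<in> verts G \<and> out_degree G v = 1"

definition supporting :: "('a, 'b) pre_digraph \<Rightarrow> 'a \<Rightarrow> bool" where
  "supporting G v \<longleftrightarrow> v \<in> verts G \<and> (\<exists>u. pendant G u \<and> v \<rightarrow>\<^bsub>G\<^esub> u)"

definition total_dominating_set :: "('a, 'b) pre_digraph \<Rightarrow> 'a set \<Rightarrow> bool" where
  "total_dominating_set G D \<longleftrightarrow>
     D \<subseteq> verts G \<and> (\<forall>v \<in> verts G. \<exists>u \<in> D. v \<rightarrow>\<^bsub>G\<^esub> u)"

text \<open>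
  For a graph with a single vertex the truncated index \<open>n - 2\<close> is \<open>0\<close>, and the count is
  \<open>0\<close>, as for a negative size, since the empty set does not dominate that vertex.
\<close>

definition total_dominating_count :: "('a, 'b) pre_digraph \<Rightarrow> nat \<Rightarrow> nat" where
  "total_dominating_count G i = card {D. total_dominating_set G D \<and> card D = i}"

end

theory Submission
  imports Defs
begin

text \<open>
  The difference \<open>(n choose 2) - (r choose 2) - r(n - r)\<close> counts the two-element sets \<open>S\<close> of
  non-supporting vertices. If the complement of such an \<open>S\<close> is not total dominating, then some
  vertex \<open>v\<close> has all its neighbours in \<open>S\<close>. It has at least one neighbour by connectedness; it
  does not have exactly one, since that neighbour would be supporting. Hence \<open>v\<close> has degree
  \<open>2\<close> and \<open>S\<close> is its neighbourhood, so at most as many sets \<open>S\<close> are of this kind as there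
  are vertices of degree \<open>2\<close>.
\<close>

text \<open>Without parallel arcs, an arc leaving \<open>v\<close> is determined by its head, so
  \<open>head G\<close> is injective on \<open>out_arcs G v\<close>.\<close>

lemma (in digraph) out_degree_eq_card_neighbours:
  "out_degree G v = card {u. v \<rightarrow> u}"
proof -
  have inj: "inj_on (head G) (out_arcs G v)"
    by (rule inj_onI) (auto simp: out_arcs_def arc_to_ends_def intro: no_multi_arcs)
  have "{u. v \<rightarrow> u} = head G ` out_arcs G v"
    by (auto simp: out_arcs_def arcs_ends_conv)
  with inj show ?thesis
    by (simp add: out_degree_def card_image)
qed

text \<open>The first step of a walk from \<open>v\<close> to \<open>w\<close> gives the neighbour;
  \<open>w\<close> rules out the one-vertex graph.\<close>

lemma (in graph) connected_imp_adjacent: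
  assumes "connected G" "v \<in> verts G" "w \<in> verts G" "v \<noteq> w"
  shows "\<exists>u. v \<rightarrow> u"
proof -
  have "v \<rightarrow>\<^sup>* w"
    using assms sym_arcs
    by (auto simp: connected_def strongly_connected_def reachable_mk_symmetric_eq)
  then show ?thesis
    using \<open>v \<noteq> w\<close> by (cases rule: converse_reachable_cases) auto
qed

lemma (in graph) unique_neighbour_supporting:
  assumes "{u. v \<rightarrow> u} = {w}"
  shows "supporting G w"
proof -
  have "v \<rightarrow> w"
    using assms by blast
  then have "w \<rightarrow> v" "v \<in> verts G" "w \<in> verts G"
    using arcs_ends_symmetric[OF sym_arcs] by auto
  moreover have "out_degree G v = 1"
    using assms by (simp add: out_degree_eq_card_neighbours)
  ultimately show ?thesis
    by (auto simp: supporting_def pendant_def)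
qed

lemma (in graph) total_dominating_or_neighbourhood:
  assumes "connected G" and S: "S \<subseteq> verts G" "card S = 2"
    and non_supporting: "\<And>w. w \<in> S \<Longrightarrow> \<not> supporting G w"
  shows "total_dominating_set G (verts G - S) \<or>
    (\<exists>v \<in> verts G. out_degree G v = 2 \<and> S = {u. v \<rightarrow> u})"
proof (rule disjCI)
  assume no_nbh: "\<not> (\<exists>v \<in> verts G. out_degree G v = 2 \<and> S = {u. v \<rightarrow> u})"
  have fin: "finite S"
    using S(2) card.infinite by fastforce
  have "\<exists>u \<in> verts G - S. v \<rightarrow> u" if v: "v \<in> verts G" for v
  proof (rule ccontr)
    let ?N = "{u. v \<rightarrow> u}"
    assume "\<not> (\<exists>u \<in> verts G - S. v \<rightarrow> u)"
    then have sub: "?N \<subseteq> S"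
      using adj_in_verts by blast
    \<comment> \<open>One of the two elements of \<open>S\<close> differs from \<open>v\<close>, so
      connectedness gives \<open>v\<close> a neighbour.\<close>
    obtain w where "w \<in> S" "w \<noteq> v"
      using S(2) by (auto simp: card_2_iff)
    then have "?N \<noteq> {}"
      using connected_imp_adjacent[OF \<open>connected G\<close> v] S(1) by blast
    moreover have "finite ?N" "card ?N \<le> 2"
      using finite_subset[OF sub fin] card_mono[OF fin sub] S(2) by auto
    ultimately have "card ?N = 1 \<or> card ?N = 2"
      by (cases "card ?N") auto
    then show False
    proof
      assume "card ?N = 1"
      then obtain x where "?N = {x}"
        by (auto simp: card_1_singleton_iff)
      then show False
        using unique_neighbour_supporting[of v x] non_supporting[of x] sub by auto
    next
      assume c: "card ?N = 2"
      then have "S = ?N"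
        using card_subset_eq[OF fin sub] S(2) by simp
      then show False
        using no_nbh v c out_degree_eq_card_neighbours by auto
    qed
  qed
  then show "total_dominating_set G (verts G - S)"
    by (auto simp: total_dominating_set_def)
qed

text \<open>A pair from a disjoint union lies in the first part, meets both parts, or lies in the
  second.\<close>

lemma choose_two_add: "(a + b) choose 2 = (a choose 2) + a * b + (b choose 2)"
  by (induction b) (simp_all add: numeral_2_eq_2)

theorem theorem8:
  fixes G :: "('a, 'b) pre_digraph" and n r :: nat
  assumes "graph G"
    and "connected G"
    and "n = card (verts G)"
    and "r = card {v. supporting G v}"
  shows "int (card {v \<in> verts G. out_degree G v = 2}) \<ge>
    int (n choose 2) - int (r choose 2) - int r * (int n - int r)
      - int (total_dominating_count G (n - 2))"
proof -
  interpret graph G by fact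
  let ?R = "{v. supporting G v}"
  let ?U = "verts G - ?R"
  let ?P = "{S. S \<subseteq> ?U \<and> card S = 2}"
  let ?T = "{D. total_dominating_set G D \<and> card D = n - 2}"
  let ?B = "{v \<in> verts G. out_degree G v = 2}"
  have R: "?R \<subseteq> verts G"
    by (auto simp: supporting_def)
  then have finR: "finite ?R" and "r \<le> n"
    using assms(3,4) by (auto intro: finite_subset card_mono)
  have cardU: "card ?U = n - r"
    using R finR assms(3,4) by (simp add: card_Diff_subset)
  have finT: "finite ?T"
    by (rule finite_subset[of _ "Pow (verts G)"]) (auto simp: total_dominating_set_def)
  \<comment> \<open>Covering by images suffices for the count, since an image is never larger than
    its source. Truncation in \<open>n - 2\<close> is harmless: a set in \<open>?P\<close> exists
    only if n \<ge> 2.\<close>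
  have "?P \<subseteq> (\<lambda>D. verts G - D) ` ?T \<union> (\<lambda>v. {u. v \<rightarrow>\<^bsub>G\<^esub> u}) ` ?B"
  proof
    fix S assume "S \<in> ?P"
    then have S: "S \<subseteq> verts G" "card S = 2" "\<And>w. w \<in> S \<Longrightarrow> \<not> supporting G w"
      by auto
    have "verts G - (verts G - S) = S" "card (verts G - S) = n - 2"
      using S(1,2) assms(3) finite_subset[OF S(1)] by (auto simp: card_Diff_subset)
    then show "S \<in> (\<lambda>D. verts G - D) ` ?T \<union> (\<lambda>v. {u. v \<rightarrow>\<^bsub>G\<^esub> u}) ` ?B"
      using total_dominating_or_neighbourhood[OF \<open>connected G\<close> S] by blast
  qed
  then have "card ?P \<le> card ((\<lambda>D. verts G - D) ` ?T \<union> (\<lambda>v. {u. v \<rightarrow>\<^bsub>G\<^esub> u}) ` ?B)"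
    using finT by (intro card_mono) auto
  also have "\<dots> \<le> card ?T + card ?B"
    using finT by (intro order_trans[OF card_Un_le] add_mono card_image_le) auto
  finally have "(n - r) choose 2 \<le> total_dominating_count G (n - 2) + card ?B"
    by (simp add: n_subsets cardU total_dominating_count_def)
  \<comment> \<open>Split the vertices into \<open>r\<close> supporting and \<open>n - r\<close>
    other ones; r \<le> n makes the natural difference agree with the integer one.\<close>
  moreover have "int (n choose 2) = int (r choose 2) + int r * (int n - int r) + int ((n - r) choose 2)"
    using choose_two_add[of r "n - r"] \<open>r \<le> n\<close> by (simp add: of_nat_diff)
  ultimately show ?thesis
    by linarith
qed

end
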